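(* Let $r\ge 4$ and $t\ge 1$ be integers, let $n=t+1$ and $q=(r-2)t+1$, and let $H=H(n,r,q\mid\sigma)$ with $\sigma=(r-1,1)$. Then: (1) $H$ is $(2,2)$-colourable; (2) $\chi(H)=t+1\ge\sqrt{\frac{|V(H)|}{r-2}}$; (3) $H$ has no $(r+1)$-clique, i.e. $\omega(H)\le r$; (4) the number of edges of $H$ is $t(t+1)((r-2)t+1)\binom{(r-2)t+1}{r-1}$, which is $O(r\,t^{r+2}e^{r-1})$.
   Context: For positive integers $n,r,q$ and a partition $\sigma$ of $r$ (multiset of positive integers summing to $r$), the $\sigma$-hypergraph $H(n,r,q\mid\sigma)$ is the $r$-uniform hypergraph whose vertex set has $nq$ vertices partitioned into $n$ classes $V_1,\dots,V_n$ of $q$ vertices each, in which an $r$-subset $K$ of vertices is an edge if and only if the multiset of non-zero values among $|K\cap V_1|,\dots,|K\cap V_n|$ equals $\sigma$. A $(2,2)$-colouring is a vertex colouring in which every edge contains vertices of exactly two distinct colours. $\chi(H)$ is the minimum number of colours in a vertex colouring with no monochromatic edge. A clique is a set $S$ of vertices such that every $r$-subset of $S$ is an edge; $\omega(H)$ is the maximum size of a clique. *)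

theory Defs
  imports Complex_Main "HOL-Library.Multiset" "HOL-Library.Landau_Symbols"
begin

record 'a hypergraph =
  verts :: "'a set"
  edges :: "'a set set"

definition vclass :: "nat \<Rightarrow> nat \<Rightarrow> (nat \<times> nat) set" where
  "vclass q i = {i} \<times> {1..q}"

text \<open>The vertex \<open>(i, j)\<close> is the \<open>j\<close>-th vertex of the \<open>i\<close>-th class.\<close>

definition sigma_hypergraph ::
  "nat \<Rightarrow> nat \<Rightarrow> nat \<Rightarrow> nat multiset \<Rightarrow> (nat \<times> nat) hypergraph" where
  "sigma_hypergraph n r q \<sigma> =
    \<lparr> verts = (\<Union>i\<in>{1..n}. vclass q i),
      edges = {K. K \<subseteq> (\<Union>i\<in>{1..n}. vclass q i) \<and> card K = r \<and>
        filter_mset (\<lambda>k. k \<noteq> 0) {#card (K \<inter> vclass q i). i \<in># mset_set {1..n}#} = \<sigma>} \<rparr>"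

definition two_two_colourable :: "'a hypergraph \<Rightarrow> bool" where
  "two_two_colourable H \<longleftrightarrow> (\<exists>c :: 'a \<Rightarrow> nat. \<forall>e\<in>edges H. card (c ` e) = 2)"

definition monochromatic :: "('a \<Rightarrow> 'c) \<Rightarrow> 'a set \<Rightarrow> bool" where
  "monochromatic c e \<longleftrightarrow> (\<exists>a. \<forall>v\<in>e. c v = a)"

definition colourable :: "nat \<Rightarrow> 'a hypergraph \<Rightarrow> bool" where
  "colourable k H \<longleftrightarrow>
    (\<exists>c :: 'a \<Rightarrow> nat. c ` verts H \<subseteq> {..<k} \<and> (\<forall>e\<in>edges H. \<not> monochromatic c e))"

definition chromatic_number :: "'a hypergraph \<Rightarrow> nat" where
  "chromatic_number H = (LEAST k. colourable k H)"

text \<open>For an \<open>r\<close>-uniform hypergraph; sets with fewer than \<open>r\<close> vertices are vacuously cliques.\<close>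

definition is_clique :: "nat \<Rightarrow> 'a hypergraph \<Rightarrow> 'a set \<Rightarrow> bool" where
  "is_clique r H S \<longleftrightarrow> S \<subseteq> verts H \<and> (\<forall>K. K \<subseteq> S \<and> card K = r \<longrightarrow> K \<in> edges H)"

definition clique_number :: "nat \<Rightarrow> 'a hypergraph \<Rightarrow> nat" where
  "clique_number r H = Max {card S |S. is_clique r H S}"

end

theory Submission
  imports Defs
begin

text \<open>
  An edge consists of \<open>r - 1\<close> vertices of one class and one vertex of another, so colouring every
  vertex by its class gives each edge exactly two colours. Conversely, with at most \<open>t\<close> colours
  each class of size \<open>(r - 2) t + 1\<close> contains \<open>r - 1\<close> vertices of equal colour, and two of the
  \<open>t + 1\<close> classes share such a colour, which yields a monochromatic edge. In a clique with \<open>r + 1\<close>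
  vertices, an edge with large part \<open>A\<close> stays an edge when a vertex of \<open>A\<close> is traded for the
  remaining vertex of the clique; this forces the latter into the class of \<open>A\<close>, which then contains
  \<open>r\<close> vertices of the clique. The growth estimate is
  \<open>(q choose k) \<le> (e q / k)\<^sup>k\<close> with \<open>q \<le> k t\<close>.
\<close>

section \<open>Edges as a large part in one class plus one vertex of another\<close>

text \<open>\<open>mset_set\<close> has no repeated elements, so a two-element image multiset comes
  from two distinct indices, even when \<open>a = b\<close>. This turns the multiset condition in
  the definition of edges into a statement about sets of indices.\<close>

lemma filter_nonzero_image_mset_eq_pair_iff:
  fixes f :: "'a \<Rightarrow> nat"
  assumes "finite I"
  shows "filter_mset (\<lambda>k. k \<noteq> 0) (image_mset f (mset_set I)) = {#a, b#} \<longleftrightarrow>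
    (\<exists>i j. i \<noteq> j \<and> {x\<in>I. f x \<noteq> 0} = {i, j} \<and> f i = a \<and> f j = b)"
proof -
  define J where "J = {x\<in>I. f x \<noteq> 0}"
  have fin: "finite J" using assms by (simp add: J_def)
  have eq: "filter_mset (\<lambda>k. k \<noteq> 0) (image_mset f (mset_set I)) = image_mset f (mset_set J)"
    using assms by (simp add: filter_mset_image_mset filter_mset_mset_set J_def)
  have "image_mset f (mset_set J) = {#a, b#} \<longleftrightarrow> (\<exists>i j. i \<noteq> j \<and> J = {i, j} \<and> f i = a \<and> f j = b)"
  proof
    assume "image_mset f (mset_set J) = {#a, b#}"
    then obtain M i where M: "mset_set J = add_mset i M" "f i = a" "image_mset f M = {#b#}"
      by (metis msed_map_invR)
    from M(3) obtain N j where N: "M = add_mset j N" "f j = b" "image_mset f N = {#}"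
      by (metis msed_map_invR)
    have ms: "mset_set J = {#i, j#}" using M N by simp
    then have "set_mset (mset_set J) = {i, j}" by simp
    then have "J = {i, j}" using fin by simp
    moreover have "i \<noteq> j"
    proof
      assume "i = j"
      with ms have "count (mset_set J) i = 2" by simp
      then show False by (metis count_mset_set' one_eq_numeral_iff num.distinct(1) zero_neq_numeral)
    qed
    ultimately show "\<exists>i j. i \<noteq> j \<and> J = {i, j} \<and> f i = a \<and> f j = b" using M N by blast
  next
    assume "\<exists>i j. i \<noteq> j \<and> J = {i, j} \<and> f i = a \<and> f j = b"
    then show "image_mset f (mset_set J) = {#a, b#}" by auto
  qed
  then show ?thesis unfolding eq by (simp add: J_def)
qed

lemma vclass_disjoint: "i \<noteq> j \<Longrightarrow> vclass q i \<inter> vclass q j = {}"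
  by (auto simp: vclass_def)

lemma finite_vclass: "finite (vclass q i)"
  by (simp add: vclass_def)

lemma card_vclass: "card (vclass q i) = q"
  by (simp add: vclass_def card_cartesian_product)

lemma fst_vclass: "v \<in> vclass q i \<Longrightarrow> fst v = i"
  by (auto simp: vclass_def)

lemma verts_sigma_hypergraph: "verts (sigma_hypergraph n r q \<sigma>) = {1..n} \<times> {1..q}"
  by (auto simp: sigma_hypergraph_def vclass_def)

text \<open>This is the form in which edges are used below. With \<open>r - 1 > 0\<close>, the class
  of the large part \<open>A\<close> is counted among the non-zero intersections; all classes other
  than those of \<open>A\<close> and \<open>b\<close> miss \<open>K\<close>.\<close>

lemma edges_sigma_hypergraph_iff:
  assumes "r \<ge> 2"
  shows "K \<in> edges (sigma_hypergraph n r q {#r - 1, 1#}) \<longleftrightarrow>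
    (\<exists>i\<in>{1..n}. \<exists>j\<in>{1..n} - {i}. \<exists>A b.
       A \<subseteq> vclass q i \<and> card A = r - 1 \<and> b \<in> vclass q j \<and> K = insert b A)" (is "?L \<longleftrightarrow> ?R")
proof -
  have L_iff: "?L \<longleftrightarrow> K \<subseteq> (\<Union>i\<in>{1..n}. vclass q i) \<and> card K = r \<and>
      (\<exists>i j. i \<noteq> j \<and> {x\<in>{1..n}. card (K \<inter> vclass q x) \<noteq> 0} = {i, j}
        \<and> card (K \<inter> vclass q i) = r - 1 \<and> card (K \<inter> vclass q j) = 1)"
    unfolding sigma_hypergraph_def hypergraph.select_convs mem_Collect_eq
      filter_nonzero_image_mset_eq_pair_iff[OF finite_atLeastAtMost] ..
  show ?thesis
  proof
    assume ?L
    then have sub: "K \<subseteq> (\<Union>i\<in>{1..n}. vclass q i)"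
      and "\<exists>i j. i \<noteq> j \<and> {x\<in>{1..n}. card (K \<inter> vclass q x) \<noteq> 0} = {i, j}
             \<and> card (K \<inter> vclass q i) = r - 1 \<and> card (K \<inter> vclass q j) = 1"
      unfolding L_iff by blast+
    then obtain i j where ij: "i \<noteq> j" "{x\<in>{1..n}. card (K \<inter> vclass q x) \<noteq> 0} = {i, j}"
        "card (K \<inter> vclass q i) = r - 1" "card (K \<inter> vclass q j) = 1" by blast
    obtain b where b: "K \<inter> vclass q j = {b}" using ij(4) by (auto simp: card_1_singleton_iff)
    have "v \<in> insert b (K \<inter> vclass q i)" if v: "v \<in> K" for v
    proof -
      obtain x where x: "x \<in> {1..n}" "v \<in> vclass q x" using sub v by blast
      then have "card (K \<inter> vclass q x) \<noteq> 0" using v finite_vclass by auto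
      then have "x \<in> {i, j}" using x ij(2) by blast
      then show ?thesis using x b v by auto
    qed
    then have "K = insert b (K \<inter> vclass q i)" using b by blast
    then show ?R using ij b
      by (intro bexI[of _ i] bexI[of _ j] exI[of _ "K \<inter> vclass q i"] exI[of _ b]) auto
  next
    assume ?R
    then obtain i j A b where *: "i \<in> {1..n}" "j \<in> {1..n}" "i \<noteq> j" "A \<subseteq> vclass q i" "card A = r - 1"
      "b \<in> vclass q j" "K = insert b A" by blast
    have fA: "finite A" using * finite_vclass finite_subset by metis
    have bA: "b \<notin> A" using * vclass_disjoint by blast
    have Ki: "K \<inter> vclass q i = A" using * vclass_disjoint by blast
    have Kj: "K \<inter> vclass q j = {b}" using * vclass_disjoint by blast
    have Kx: "K \<inter> vclass q x = {}" if "x \<noteq> i" "x \<noteq> j" for x using * that vclass_disjoint by blast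
    have "card (K \<inter> vclass q x) \<noteq> 0 \<longleftrightarrow> x = i \<or> x = j" for x
      using Ki Kj Kx[of x] *(5) assms by (cases "x = i"; cases "x = j") simp_all
    then have "{x\<in>{1..n}. card (K \<inter> vclass q x) \<noteq> 0} = {i, j}" using * by blast
    moreover have "card K = r" using * fA bA assms by simp
    moreover have "K \<subseteq> (\<Union>i\<in>{1..n}. vclass q i)" using * by blast
    moreover have "card (K \<inter> vclass q i) = r - 1" "card (K \<inter> vclass q j) = 1"
      unfolding Ki Kj by (simp_all add: *(5))
    ultimately show ?L unfolding L_iff using *(3) by blast
  qed
qed

lemma edge_sigma_hypergraphE:
  assumes "r \<ge> 2" "e \<in> edges (sigma_hypergraph n r q {#r - 1, 1#})"
  obtains i j A b where "i \<noteq> j" "A \<subseteq> vclass q i" "card A = r - 1" "b \<in> vclass q j" "e = insert b A"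
  using assms(2) unfolding edges_sigma_hypergraph_iff[OF assms(1)]
  by (elim bexE exE conjE) (rule that, auto)

section \<open>Colourings and the chromatic number\<close>

text \<open>The large part is non-empty and has a single class index, and the remaining vertex
  contributes a different one. Hence \<open>fst\<close> serves as a (2,2)-colouring.\<close>

lemma card_fst_edge:
  assumes "r \<ge> 2" "e \<in> edges (sigma_hypergraph n r q {#r - 1, 1#})"
  shows "card (fst ` e) = 2"
proof -
  obtain i j A b where *: "i \<noteq> j" "A \<subseteq> vclass q i" "card A = r - 1" "b \<in> vclass q j" "e = insert b A"
    using assms by (rule edge_sigma_hypergraphE)
  have "A \<noteq> {}" using * assms by auto
  moreover have "fst ` A \<subseteq> {i}" using *(2) fst_vclass by blast
  ultimately have "fst ` A = {i}" by blast
  then show ?thesis using * fst_vclass[of b] by simp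
qed

lemma colourable_sigma_hypergraph:
  assumes "r \<ge> 2"
  shows "colourable n (sigma_hypergraph n r q {#r - 1, 1#})"
  unfolding colourable_def
proof (intro exI conjI ballI)
  show "(\<lambda>v. fst v - 1) ` verts (sigma_hypergraph n r q {#r - 1, 1#}) \<subseteq> {..<n}"
    by (auto simp: verts_sigma_hypergraph)
next
  fix e assume e: "e \<in> edges (sigma_hypergraph n r q {#r - 1, 1#})"
  show "\<not> monochromatic (\<lambda>v. fst v - 1) e"
  proof
    assume "monochromatic (\<lambda>v. fst v - 1) e"
    then obtain a where a: "\<forall>v\<in>e. fst v - 1 = a" by (auto simp: monochromatic_def)
    have "e \<subseteq> {1..n} \<times> {1..q}"
      using e by (auto simp: sigma_hypergraph_def vclass_def)
    \<comment> \<open>Classes are numbered from 1, so the truncated subtraction loses nothing, and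
      the shifted colouring still separates the classes.\<close>
    then have "fst v = Suc a" if "v \<in> e" for v
      using a that by fastforce
    then have "fst ` e \<subseteq> {Suc a}" by auto
    then have "card (fst ` e) \<le> 1"
      using card_mono[of "{Suc a}" "fst ` e"] by simp
    then show False using card_fst_edge[OF assms e] by simp
  qed
qed

lemma colour_class_pigeonhole:
  assumes "f ` V \<subseteq> {..<k}" "card V > m * k"
  shows "\<exists>c<k. card {v\<in>V. f v = c} > m"
proof (rule ccontr)
  assume "\<not> ?thesis"
  then have le: "card {v\<in>V. f v = c} \<le> m" if "c < k" for c using that not_less by blast
  have "V = (\<Union>c<k. {v\<in>V. f v = c})" using assms(1) by auto
  then have "card V \<le> (\<Sum>c<k. card {v\<in>V. f v = c})"
    using card_UN_le[of "{..<k}" "\<lambda>c. {v\<in>V. f v = c}"] by simp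
  also have "\<dots> \<le> (\<Sum>c<k. m)" using le by (intro sum_mono) simp
  finally show False using assms(2) by (simp add: mult.commute)
qed

text \<open>The pigeonhole principle is applied twice: inside each class it yields a colour
  \<open>c i\<close> occurring at least \<open>r - 1\<close> times, and with fewer colours than
  classes two of these colours agree.\<close>

lemma colourable_sigma_hypergraph_lower_bound:
  assumes "r \<ge> 2" "q > (r - 2) * k" "colourable k (sigma_hypergraph n r q {#r - 1, 1#})"
  shows "n \<le> k"
proof (rule ccontr)
  assume "\<not> n \<le> k"
  obtain f :: "nat \<times> nat \<Rightarrow> nat" where f: "f ` ({1..n} \<times> {1..q}) \<subseteq> {..<k}"
      "\<forall>e\<in>edges (sigma_hypergraph n r q {#r - 1, 1#}). \<not> monochromatic f e"
    using assms(3) by (auto simp: colourable_def verts_sigma_hypergraph)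
  have "\<exists>c<k. card {v\<in>vclass q i. f v = c} > r - 2" if i: "i \<in> {1..n}" for i
  proof -
    have "f ` vclass q i \<subseteq> {..<k}" using f(1) i unfolding vclass_def by blast
    then show ?thesis
      using colour_class_pigeonhole[of f "vclass q i" k "r - 2"] assms(2) card_vclass
      by metis
  qed
  then obtain c where c: "\<And>i. i \<in> {1..n} \<Longrightarrow> c i < k \<and> card {v\<in>vclass q i. f v = c i} > r - 2"
    by metis
  have "c ` {1..n} \<subseteq> {..<k}" using c by auto
  then have "card (c ` {1..n}) \<le> k" using card_mono[of "{..<k}"] by simp
  then have "\<not> inj_on c {1..n}" using card_image[of c "{1..n}"] \<open>\<not> n \<le> k\<close> by auto
  then obtain i j where ij: "i \<in> {1..n}" "j \<in> {1..n}" "i \<noteq> j" "c i = c j"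
    by (auto simp: inj_on_def)
  have "r - 1 \<le> card {v\<in>vclass q i. f v = c i}" using c[OF ij(1)] by linarith
  then obtain A where A: "A \<subseteq> {v\<in>vclass q i. f v = c i}" "card A = r - 1"
    by (meson obtain_subset_with_card_n)
  \<comment> \<open>From the second class a single vertex of the shared colour is enough to complete
    the edge.\<close>
  have "{v\<in>vclass q j. f v = c j} \<noteq> {}" using c[OF ij(2)] by (metis card.empty not_less_zero)
  then obtain b where b: "b \<in> vclass q j" "f b = c j" by blast
  have "insert b A \<in> edges (sigma_hypergraph n r q {#r - 1, 1#})"
    unfolding edges_sigma_hypergraph_iff[OF assms(1)] using ij A b by blast
  moreover have "monochromatic f (insert b A)"
    unfolding monochromatic_def using A b ij by (intro exI[of _ "c i"]) auto
  ultimately show False using f(2) by blast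
qed

lemma chromatic_number_sigma_hypergraph:
  assumes "r \<ge> 2" "q > (r - 2) * (n - 1)"
  shows "chromatic_number (sigma_hypergraph n r q {#r - 1, 1#}) = n"
  unfolding chromatic_number_def
proof (rule Least_equality)
  show "colourable n (sigma_hypergraph n r q {#r - 1, 1#})"
    by (rule colourable_sigma_hypergraph[OF assms(1)])
next
  fix k assume k: "colourable k (sigma_hypergraph n r q {#r - 1, 1#})"
  show "n \<le> k"
  proof (rule ccontr)
    assume "\<not> n \<le> k"
    \<comment> \<open>The size assumption on \<open>q\<close> is stated for \<open>n - 1\<close>
      colours, the largest number to be excluded, and so covers every smaller
      \<open>k\<close>.\<close>
    then have "(r - 2) * k \<le> (r - 2) * (n - 1)" by (intro mult_le_mono) auto
    then have "q > (r - 2) * k" using assms(2) by linarith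
    then show False using colourable_sigma_hypergraph_lower_bound[OF assms(1) _ k] \<open>\<not> n \<le> k\<close> by blast
  qed
qed

section \<open>Cliques\<close>

text \<open>The edges left after removing \<open>v\<close>, then \<open>a\<close>, then
  \<open>b\<close> from \<open>S\<close> are compared: the first two place all of \<open>S\<close>
  except \<open>b\<close> in one class, which the third forbids.\<close>

lemma no_Suc_clique_sigma_hypergraph:
  assumes "r \<ge> 4" "is_clique r (sigma_hypergraph n r q {#r - 1, 1#}) S"
  shows "card S \<noteq> r + 1"
proof
  assume cS: "card S = r + 1"
  have r2: "r \<ge> 2" using assms(1) by simp
  have finS: "finite S" using cS by (metis card.infinite add_is_0 one_neq_zero)
  have part: "\<exists>i j A b. i \<noteq> j \<and> A \<subseteq> vclass q i \<and> card A = r - 1 \<and> b \<in> vclass q j \<and> S - {v} = insert b A"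
    if "v \<in> S" for v
  proof -
    have "card (S - {v}) = r" using cS that finS by simp
    then have "S - {v} \<in> edges (sigma_hypergraph n r q {#r - 1, 1#})"
      using assms(2) by (auto simp: is_clique_def)
    with r2 show ?thesis by (rule edge_sigma_hypergraphE) blast
  qed
  have "S \<noteq> {}" using cS by auto
  then obtain v where v: "v \<in> S" by blast
  obtain i j A b where A: "i \<noteq> j" "A \<subseteq> vclass q i" "card A = r - 1" "b \<in> vclass q j"
      "S - {v} = insert b A" using part[OF v] by blast
  have bi: "b \<notin> vclass q i" using A vclass_disjoint by blast
  have "A \<noteq> {}" using A(3) assms(1) by auto
  then obtain a where a: "a \<in> A" by blast
  have finA: "finite A" using A(2) finite_vclass finite_subset by blast
  obtain i' j' A' b' where A': "i' \<noteq> j'" "A' \<subseteq> vclass q i'" "card A' = r - 1" "b' \<in> vclass q j'"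
      "S - {a} = insert b' A'" using part[of a] a A by blast
  \<comment> \<open>Otherwise \<open>A - {a}\<close> avoids \<open>A'\<close> and must fit into
    \<open>{b'}\<close>, although it has \<open>r - 2 >= 2\<close> elements.\<close>
  have "i' = i"
  proof (rule ccontr)
    assume "i' \<noteq> i"
    have "A - {a} \<subseteq> insert b' A'" using A A' by blast
    then have "A - {a} \<subseteq> {b'}" using A(2) A'(2) vclass_disjoint[OF \<open>i' \<noteq> i\<close>] by blast
    then have "card (A - {a}) \<le> 1" using card_mono[of "{b'}" "A - {a}"] by simp
    then show False using A(3) a finA assms(1) by simp
  qed
  have "b \<in> S - {a}" using A a bi by blast
  \<comment> \<open>The only vertex of \<open>S - {a}\<close> outside class \<open>i\<close> is
    \<open>b'\<close>, and \<open>b\<close> is such a vertex.\<close>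
  then have "b = b'" using A' \<open>i' = i\<close> bi by blast
  have "v \<in> S - {a}" "v \<noteq> b" using v A a by blast+
  then have "v \<in> vclass q i" using A' \<open>i' = i\<close> \<open>b = b'\<close> by blast
  then have Si: "S - {b} \<subseteq> vclass q i" using A by blast
  \<comment> \<open>The contradiction: \<open>S - {b}\<close> is an edge and so meets two classes,
    yet it lies in class \<open>i\<close>.\<close>
  obtain i'' j'' A'' b'' where A'': "i'' \<noteq> j''" "A'' \<subseteq> vclass q i''" "card A'' = r - 1"
      "b'' \<in> vclass q j''" "S - {b} = insert b'' A''" using part[of b] A by blast
  have "A'' \<noteq> {}" using A''(3) assms(1) by auto
  then obtain x where "x \<in> A''" by blast
  then have "x \<in> vclass q i''" "x \<in> vclass q i" "b'' \<in> vclass q i" using A''(2,5) Si by blast+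
  then show False using A''(1,4) fst_vclass by metis
qed

lemma finite_clique_cards:
  assumes "finite (verts H)"
  shows "finite {card S |S. is_clique r H S}"
proof -
  have "{card S |S. is_clique r H S} \<subseteq> card ` Pow (verts H)" by (auto simp: is_clique_def)
  then show ?thesis using assms by (meson finite_Pow_iff finite_imageI finite_subset)
qed

text \<open>Subsets of cliques are cliques, so excluding the size \<open>m + 1\<close> excludes all
  larger sizes. For \<open>r > 0\<close> the empty set is a clique, so the \<open>Max\<close> is
  taken over a non-empty set.\<close>

lemma clique_number_le:
  assumes "finite (verts H)" "r > 0" "\<And>S. is_clique r H S \<Longrightarrow> card S \<noteq> m + 1"
  shows "clique_number r H \<le> m"
proof -
  have "is_clique r H {}" using assms(2) by (auto simp: is_clique_def)
  moreover have "card S \<le> m" if S: "is_clique r H S" for S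
  proof (rule ccontr)
    assume "\<not> card S \<le> m"
    then have "m + 1 \<le> card S" by simp
    then obtain T where T: "T \<subseteq> S" "card T = m + 1" by (meson obtain_subset_with_card_n)
    then have "is_clique r H T" using S by (auto simp: is_clique_def)
    then show False using T assms(3) by blast
  qed
  ultimately show ?thesis
    unfolding clique_number_def using finite_clique_cards[OF assms(1)]
    by (subst Max_le_iff) auto
qed

section \<open>Counting the edges\<close>

text \<open>Edges correspond bijectively to tuples \<open>(i, j, A, b)\<close>. Injectivity rests on
  \<open>r - 1 >= 2\<close>, which makes the large part recognisable; for \<open>r = 2\<close> each
  edge would arise from two tuples.\<close>

lemma card_edges_sigma_hypergraph:
  assumes "r \<ge> 3"
  shows "card (edges (sigma_hypergraph n r q {#r - 1, 1#})) = n * (n - 1) * q * (q choose (r - 1))"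
proof -
  define P where "P i = {A. A \<subseteq> vclass q i \<and> card A = r - 1}" for i
  define D where "D = (SIGMA i:{1..n}. SIGMA j:{1..n} - {i}. P i \<times> vclass q j)"
  define g :: "nat \<times> nat \<times> (nat \<times> nat) set \<times> nat \<times> nat \<Rightarrow> (nat \<times> nat) set"
    where "g = (\<lambda>(i, j, A, b). insert b A)"
  have r2: "r \<ge> 2" using assms by simp
  have fP: "finite (P i)" for i by (simp add: P_def finite_vclass)
  have cP: "card (P i) = q choose (r - 1)" for i
    unfolding P_def by (simp add: n_subsets finite_vclass card_vclass)
  have edges: "edges (sigma_hypergraph n r q {#r - 1, 1#}) = g ` D"
  proof (intro equalityI subsetI)
    fix K assume "K \<in> edges (sigma_hypergraph n r q {#r - 1, 1#})"
    then obtain i j A b where K: "i \<in> {1..n}" "j \<in> {1..n} - {i}" "A \<subseteq> vclass q i" "card A = r - 1"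
        "b \<in> vclass q j" "K = insert b A"
      unfolding edges_sigma_hypergraph_iff[OF r2] by (elim bexE exE conjE)
    show "K \<in> g ` D"
    proof (rule image_eqI)
      show "K = g (i, j, A, b)" by (simp add: g_def K)
      show "(i, j, A, b) \<in> D" unfolding D_def P_def using K by blast
    qed
  next
    fix K assume "K \<in> g ` D"
    then obtain x where x: "x \<in> D" "K = g x" by blast
    obtain i j A b where xx: "x = (i, j, A, b)" by (cases x)
    have K: "i \<in> {1..n}" "j \<in> {1..n} - {i}" "A \<subseteq> vclass q i" "card A = r - 1"
        "b \<in> vclass q j" "K = insert b A"
      using x by (simp_all add: xx g_def D_def P_def)
    show "K \<in> edges (sigma_hypergraph n r q {#r - 1, 1#})"
      unfolding edges_sigma_hypergraph_iff[OF r2]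
      by (intro bexI[OF _ K(1)] bexI[OF _ K(2)] exI conjI) (rule K)+
  qed
  have "inj_on g D"
  proof (rule inj_onI)
    fix x y assume x: "x \<in> D" and y: "y \<in> D" and eq: "g x = g y"
    obtain i j A b where xx: "x = (i, j, A, b)" by (cases x)
    obtain i' j' A' b' where yy: "y = (i', j', A', b')" by (cases y)
    have X: "i \<noteq> j" "A \<subseteq> vclass q i" "card A = r - 1" "b \<in> vclass q j"
      using x by (auto simp: xx D_def P_def)
    have Y: "i' \<noteq> j'" "A' \<subseteq> vclass q i'" "card A' = r - 1" "b' \<in> vclass q j'"
      using y by (auto simp: yy D_def P_def)
    have E: "insert b A = insert b' A'" using eq by (simp add: xx yy g_def)
    have "i = i'"
    proof (rule ccontr)
      assume "i \<noteq> i'"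
      \<comment> \<open>\<open>A\<close> and \<open>A'\<close> would lie in disjoint classes,
        leaving only \<open>b'\<close> for the elements of \<open>A\<close>.\<close>
      then have "A \<subseteq> {b'}" using E X(2) Y(2) vclass_disjoint[of i i' q] by blast
      then have "card A \<le> 1" using card_mono[of "{b'}" A] by simp
      then show False using X(3) assms by simp
    qed
    then have "b \<notin> vclass q i" "b' \<notin> vclass q i" using X Y vclass_disjoint by blast+
    moreover have "A' \<subseteq> vclass q i" using Y(2) \<open>i = i'\<close> by simp
    \<comment> \<open>Both \<open>b\<close> and \<open>b'\<close> are the unique vertex of the edge
      outside class \<open>i\<close>.\<close>
    ultimately have "b \<notin> A" "b \<notin> A'" "b = b'" using E X(2) by blast+
    then have "A = A'" using E by (metis insert_ident)
    moreover have "j = j'" using X(4) Y(4) \<open>b = b'\<close> fst_vclass by metis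
    ultimately show "x = y" using \<open>i = i'\<close> \<open>b = b'\<close> by (simp add: xx yy)
  qed
  then have "card (edges (sigma_hypergraph n r q {#r - 1, 1#})) = card D"
    unfolding edges by (rule card_image)
  also have "\<dots> = (\<Sum>i\<in>{1..n}. (n - 1) * ((q choose (r - 1)) * q))"
    unfolding D_def
    by (subst card_SigmaI)
       (auto simp: fP finite_vclass cP card_vclass card_cartesian_product intro!: sum.cong)
  also have "\<dots> = n * (n - 1) * q * (q choose (r - 1))" by simp
  finally show ?thesis .
qed

section \<open>Growth of the edge count\<close>

text \<open>The left side is one term of the exponential series, whose terms are all
  non-negative.\<close>

lemma power_div_fact_le_exp:
  fixes x :: real
  assumes "x \<ge> 0"
  shows "x ^ k / fact k \<le> exp x"
proof -
  have "(\<Sum>n\<in>{k}. x ^ n /\<^sub>R fact n) \<le> (\<Sum>n. x ^ n /\<^sub>R fact n)"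
    using assms by (intro sum_le_suminf summable_exp_generic) auto
  then show ?thesis by (simp add: exp_def field_simps)
qed

text \<open>Bounding the binomial coefficient by \<open>q ^ k / fact k\<close> and \<open>q\<close>
  by \<open>k * t\<close> leaves the factor \<open>k ^ k / fact k\<close>, which is at most
  \<open>exp k\<close>.\<close>

lemma binomial_le_exp_power:
  assumes "q \<le> k * t"
  shows "real (q choose k) \<le> (real t * exp 1) ^ k"
proof -
  have "real (q choose k) * fact k \<le> real q ^ k"
    using binomial_fact_pow[of q k] by (metis of_nat_fact of_nat_le_iff of_nat_mult of_nat_power)
  also have "\<dots> \<le> (real k * real t) ^ k"
    using assms by (intro power_mono) (auto simp flip: of_nat_mult)
  finally have "real (q choose k) \<le> (real k ^ k / fact k) * real t ^ k"
    by (simp add: field_simps power_mult_distrib)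
  also have "\<dots> \<le> exp (real k) * real t ^ k"
    by (intro mult_right_mono power_div_fact_le_exp) auto
  also have "exp (real k) = exp 1 ^ k" by (simp flip: exp_of_nat_mult)
  finally show ?thesis by (simp add: power_mult_distrib mult.commute)
qed

text \<open>Since \<open>1 <= t\<close>, also \<open>q <= (r - 1) * t\<close>, which feeds the
  binomial bound with \<open>k = r - 1\<close>. The constant 2 comes from
  \<open>t + 1 <= 2 * t\<close>, and the exponent \<open>r + 2\<close> from three factors
  \<open>t\<close> outside the binomial coefficient and \<open>r - 1\<close> inside.\<close>

lemma edge_count_upper_bound:
  fixes r t :: nat
  assumes "r \<ge> 4" "t \<ge> 1"
  defines "q \<equiv> (r - 2) * t + 1"
  shows "real (t * (t + 1) * q * (q choose (r - 1))) \<le> 2 * (real r * real t ^ (r + 2) * exp 1 ^ (r - 1))"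
proof -
  have "(r - 2) * t + 1 * t = (r - 1) * t"
    unfolding add_mult_distrib[symmetric] using assms(1) by (intro arg_cong2[of _ _ _ _ "(*)"]) auto
  then have q1: "q \<le> (r - 1) * t" using assms(2) unfolding q_def by linarith
  also have "\<dots> \<le> r * t" by simp
  finally have "t * (t + 1) * q \<le> t * (2 * t) * (r * t)"
    using assms(2) by (intro mult_le_mono) auto
  then have 1: "real (t * (t + 1) * q) \<le> real (t * (2 * t) * (r * t))" by (rule of_nat_mono)
  have "real (t * (t + 1) * q * (q choose (r - 1)))
      \<le> real (t * (2 * t) * (r * t)) * (real t * exp 1) ^ (r - 1)"
    unfolding of_nat_mult[of _ "q choose (r - 1)"]
    by (intro mult_mono 1 binomial_le_exp_power q1) auto
  also have "\<dots> = 2 * (real r * real t ^ (r + 2) * exp 1 ^ (r - 1))"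
  proof -
    have "r + 2 = 3 + (r - 1)" using assms(1) by simp
    then have "real t ^ (r + 2) = real t ^ 3 * real t ^ (r - 1)" by (metis power_add)
    then show ?thesis by (simp only: power_mult_distrib power3_eq_cube of_nat_mult of_nat_numeral mult_ac)
  qed
  finally show ?thesis .
qed

section \<open>The square root bound and the final assembly\<close>

text \<open>Each class has \<open>(r - 2) * t + 1\<close> vertices, at most
  \<open>(r - 2) * (t + 1)\<close> because \<open>1 <= r - 2\<close>; multiplying by the
  \<open>t + 1\<close> classes gives the square.\<close>

lemma sqrt_vertex_count_le:
  assumes "r \<ge> 3"
  shows "sqrt (real (card (verts (sigma_hypergraph (t + 1) r ((r - 2) * t + 1) \<sigma>))) / (real r - 2))
    \<le> real (t + 1)"
proof (rule real_le_lsqrt)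
  have "(t + 1) * ((r - 2) * t + 1) \<le> (t + 1) * ((r - 2) * (t + 1))"
    using assms by (intro mult_le_mono) auto
  then have "real ((t + 1) * ((r - 2) * t + 1)) \<le> real ((t + 1) * ((r - 2) * (t + 1)))"
    by (rule of_nat_mono)
  also have "\<dots> = real (t + 1) ^ 2 * (real r - 2)"
    using assms by (simp only: of_nat_mult of_nat_diff) (simp add: power2_eq_square)
  finally show "real (card (verts (sigma_hypergraph (t + 1) r ((r - 2) * t + 1) \<sigma>))) / (real r - 2)
      \<le> (real (t + 1))\<^sup>2"
    using assms by (simp add: verts_sigma_hypergraph card_cartesian_product divide_le_eq)
qed simp

theorem theorem3p3:
  "(\<forall>r t :: nat. r \<ge> 4 \<and> t \<ge> 1 \<longrightarrow>
     (let n = t + 1; q = (r - 2) * t + 1; H = sigma_hypergraph n r q {#r - 1, 1#} in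
        two_two_colourable H
      \<and> chromatic_number H = t + 1
      \<and> real (t + 1) \<ge> sqrt (real (card (verts H)) / (real r - 2))
      \<and> (\<nexists>S. is_clique r H S \<and> card S = r + 1)
      \<and> clique_number r H \<le> r
      \<and> card (edges H) = t * (t + 1) * ((r - 2) * t + 1) * (((r - 2) * t + 1) choose (r - 1))))
   \<and> (\<lambda>(r, t). real (card (edges (sigma_hypergraph (t + 1) r ((r - 2) * t + 1) {#r - 1, 1#}))))
       \<in> O[principal {(r :: nat, t :: nat). r \<ge> 4 \<and> t \<ge> 1}](
           \<lambda>(r, t). real r * real t ^ (r + 2) * exp 1 ^ (r - 1))"
proof -
  have count: "card (edges (sigma_hypergraph (t + 1) r ((r - 2) * t + 1) {#r - 1, 1#}))
      = t * (t + 1) * ((r - 2) * t + 1) * (((r - 2) * t + 1) choose (r - 1))"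
    if "r \<ge> 4" for r t :: nat
    using card_edges_sigma_hypergraph[of r "t + 1" "(r - 2) * t + 1"] that
    by (simp add: mult.commute)
  show ?thesis
  proof (intro conjI allI impI)
    fix r t :: nat assume rt: "r \<ge> 4 \<and> t \<ge> 1"
    define H where "H = sigma_hypergraph (t + 1) r ((r - 2) * t + 1) {#r - 1, 1#}"
    have "two_two_colourable H"
      unfolding two_two_colourable_def H_def using card_fst_edge[of r] rt
      by (intro exI[of _ fst]) auto
    moreover have "chromatic_number H = t + 1"
      unfolding H_def using rt by (intro chromatic_number_sigma_hypergraph) auto
    moreover have "real (t + 1) \<ge> sqrt (real (card (verts H)) / (real r - 2))"
      unfolding H_def using rt by (intro sqrt_vertex_count_le) auto
    moreover have clique: "card S \<noteq> r + 1" if "is_clique r H S" for S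
      using no_Suc_clique_sigma_hypergraph that rt unfolding H_def by blast
    moreover have "clique_number r H \<le> r"
      using rt clique by (intro clique_number_le) (auto simp: H_def verts_sigma_hypergraph)
    moreover have "card (edges H) = t * (t + 1) * ((r - 2) * t + 1) * (((r - 2) * t + 1) choose (r - 1))"
      unfolding H_def using rt by (intro count) simp
    ultimately show "let n = t + 1; q = (r - 2) * t + 1; H = sigma_hypergraph n r q {#r - 1, 1#} in
        two_two_colourable H
      \<and> chromatic_number H = t + 1
      \<and> real (t + 1) \<ge> sqrt (real (card (verts H)) / (real r - 2))
      \<and> (\<nexists>S. is_clique r H S \<and> card S = r + 1)
      \<and> clique_number r H \<le> r
      \<and> card (edges H) = t * (t + 1) * ((r - 2) * t + 1) * (((r - 2) * t + 1) choose (r - 1))"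
      unfolding Let_def H_def[symmetric] by blast
  next
    \<comment> \<open>Over a principal filter, "eventually" means everywhere on the set, so the
      O-bound is uniform in \<open>r\<close> and \<open>t\<close> and needs one constant for all
      pairs, here 2.\<close>
    have "norm (real (card (edges (sigma_hypergraph (t + 1) r ((r - 2) * t + 1) {#r - 1, 1#}))))
        \<le> 2 * norm (real r * real t ^ (r + 2) * exp 1 ^ (r - 1))"
      if "r \<ge> 4" "t \<ge> 1" for r t :: nat
      using edge_count_upper_bound[OF that] unfolding count[OF that(1)]
      by (simp add: abs_mult)
    then show "(\<lambda>(r, t). real (card (edges (sigma_hypergraph (t + 1) r ((r - 2) * t + 1) {#r - 1, 1#}))))
       \<in> O[principal {(r :: nat, t :: nat). r \<ge> 4 \<and> t \<ge> 1}](
           \<lambda>(r, t). real r * real t ^ (r + 2) * exp 1 ^ (r - 1))"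
      by (intro bigoI[of _ 2]) (auto simp: eventually_principal)
  qed
qed

end
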